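(* For every $p\ge q\ge d+1$ there exists $c=c(p,q,d)$ such that the following holds. Let $P$ be a monotone property of boxes and let $\mathcal{B}$ be a finite family of boxes in $\mathbb{R}^d$. If among every $p$ boxes of $\mathcal{B}$ some $q$ are $P$-intersecting, then there exists a family $\mathcal{S}$ of boxes with property $P$ such that $|\mathcal{S}|\le c$ and for every $B\in\mathcal{B}$ there is a $D\in\mathcal{S}$ with $D\subseteq B$.
   Context: A box in $\mathbb{R}^d$ is an axis-parallel box, i.e. a set of the form $[a_1,b_1]\times\cdots\times[a_d,b_d]$ (an intersection of $2d$ closed coordinate halfspaces, one for each direction $\pm e_i$); degenerate boxes and the empty set are allowed, so that an intersection of boxes is a box. A property $P$ of boxes (a class of boxes) is monotone if $B\in P$ and $B\subseteq C$ imply $C\in P$ for all boxes $B,C$. A family of boxes is $P$-intersecting if the intersection of its members has property $P$. Here $p$ and $q$ are integers.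
   Formalization: The formal theorem also assumes that every box of the family has property P; without this the claim fails (P empty, a family of one box, so the condition on p boxes is vacuous), and by monotonicity the conclusion itself forces it. *)

theory Defs
  imports "HOL-Analysis.Analysis"
begin

(* cbox a b is empty as soon as b $ i < a $ i for some i, so the empty set is a box. *)
definition boxes :: "(real ^ 'n) set set" where
  "boxes = {B. \<exists>a b. B = cbox a b}"

definition monotone_box_property :: "(real ^ 'n) set set \<Rightarrow> bool" where
  "monotone_box_property P \<longleftrightarrow>
     P \<subseteq> boxes \<and> (\<forall>B\<in>boxes. \<forall>C\<in>boxes. B \<in> P \<longrightarrow> B \<subseteq> C \<longrightarrow> C \<in> P)"

definition intersecting :: "(real ^ 'n) set set \<Rightarrow> (real ^ 'n) set set \<Rightarrow> bool" where
  "intersecting P F \<longleftrightarrow> \<Inter>F \<in> P"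

(* The boxes chosen are pairwise distinct, and the (p,q) condition is vacuous for families with
   fewer than p members.  The condition does not imply that every member of the family has
   property P, whereas any member containing a box with property P has property P itself;
   (p,q) theorems therefore need that membership as a separate assumption. *)
definition pq_condition ::
    "(real ^ 'n) set set \<Rightarrow> nat \<Rightarrow> nat \<Rightarrow> (real ^ 'n) set set \<Rightarrow> bool" where
  "pq_condition P p q \<B> \<longleftrightarrow>
     (\<forall>G\<subseteq>\<B>. card G = p \<longrightarrow> (\<exists>F\<subseteq>G. card F = q \<and> intersecting P F))"

end

theory Submission
  imports Defs "HOL-Library.Ramsey"
begin

text \<open>
  Code the box with lower corner \<open>a\<close> and upper corner \<open>b\<close> by the vector \<open>(-a, b)\<close> with
  \<open>2d\<close> coordinates.  Inclusion of boxes then follows from the coordinatewise order, intersection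
  becomes the coordinatewise minimum \<open>inf\<close>, and a monotone property becomes an up-set \<open>U\<close>.  If
  \<open>q \<ge> 2\<close> boxes are \<open>P\<close>-intersecting then, by monotonicity, so are any two of them.  What has to
  be shown is therefore a statement about the coordinatewise order (\<open>up_set_pq\<close>): if \<open>W\<close> is a finite
  subset of \<open>U\<close> and among any \<open>p\<close> points of \<open>W\<close> two have their minimum in \<open>U\<close>, then boundedly many
  points of \<open>U\<close> suffice to have one of them below each point of \<open>W\<close>.

  The proof runs through a fractional version.  For every weight on \<open>W\<close> there is a heavy point: some
  \<open>u\<close> in \<open>U\<close> lies below a constant proportion of the weight (\<open>heavy_point\<close>).  Otherwise a random
  sample of bounded size \<open>r\<close> would, with positive probability, contain no three members
  \<open>x\<close>, \<open>y\<close>, \<open>z\<close> such that \<open>inf x y\<close> is in \<open>U\<close> and below \<open>z\<close>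
  (\<open>sample_avoiding_sparse_triples\<close>).  But such a triple exists in every long
  sequence of points of \<open>W\<close> (\<open>middle_above_meet\<close>): Ramsey's theorem yields a long subsequence that is monotone in each
  coordinate and on which all pairwise minima are in \<open>U\<close>, and in such a sequence each
  point is above the minimum of any earlier and any later point.

  Heavy points for all weights give, by the multiplicative weights method in place of linear
  programming duality, a finite list of points of \<open>U\<close> of which a constant proportion lies below
  each \<open>w\<close> in \<open>W\<close> (\<open>uniform_list_of_heavy_points\<close>).  The length of this list depends on \<open>W\<close>, but
  the list can be replaced by the points of \<open>U\<close> on the grid of its coordinatewise quantiles, whose
  size is bounded (\<open>grid_net\<close>): rounding \<open>w\<close> down to the grid loses only few members of the list, so
  some member stays below the rounded point, which is then in \<open>U\<close>.
\<close>

section \<open>Monotone subsequences by Ramsey's theorem\<close>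

text \<open>
  The colour of a pair may depend on the order of its two elements, and the colours come from an
  arbitrary finite type; both make the coding of several simultaneous conditions direct.
\<close>
lemma ramsey_pairs_coloured:
  fixes s :: nat
  shows "\<exists>N. \<forall>g :: nat \<Rightarrow> nat \<Rightarrow> 'c::finite. \<exists>c. \<exists>H\<subseteq>{..<N}. card H = s \<and>
           (\<forall>i\<in>H. \<forall>j\<in>H. i < j \<longrightarrow> g i j = c)"
proof -
  obtain N where N: "partn_lst {..<N::nat} (replicate CARD('c) s) 2"
    using ramsey_full by blast
  obtain idx :: "'c \<Rightarrow> nat" where idx: "bij_betw idx UNIV {..<CARD('c)}"
    using ex_bij_betw_finite_nat[of "UNIV :: 'c set"] by (auto simp: atLeast0LessThan)
  have "\<exists>c. \<exists>H\<subseteq>{..<N}. card H = s \<and> (\<forall>i\<in>H. \<forall>j\<in>H. i < j \<longrightarrow> g i j = c)"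
    for g :: "nat \<Rightarrow> nat \<Rightarrow> 'c"
  proof -
    have "(\<lambda>e. idx (g (Min e) (Max e))) \<in> nsets {..<N} 2 \<rightarrow> {..<CARD('c)}"
      using idx by (auto simp: bij_betw_def)
    then obtain a H where a: "a < CARD('c)" and H: "H \<in> nsets {..<N} s"
      and mono: "(\<lambda>e. idx (g (Min e) (Max e))) ` nsets H 2 \<subseteq> {a}"
      by (rule partn_lstE[OF N]) auto
    have "g i j = inv idx a" if "i \<in> H" "j \<in> H" "i < j" for i j
    proof -
      have "{i, j} \<in> nsets H 2" using that by auto
      then have "idx (g (Min {i, j}) (Max {i, j})) = a" using mono by blast
      then have "idx (g i j) = a" using that by simp
      then show ?thesis using idx by (metis bij_betw_imp_inj_on inv_f_f)
    qed
    then show ?thesis using H by (auto simp: nsets_def)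
  qed
  then show ?thesis by blast
qed

lemma obtain_three_increasing:
  fixes H :: "nat set"
  assumes "card H \<ge> 3"
  obtains i j k where "i \<in> H" "j \<in> H" "k \<in> H" "i < j" "j < k"
proof -
  obtain H' where H': "H' \<subseteq> H" "card H' = 3"
    using assms obtain_subset_with_card_n by metis
  then have "H' \<in> nsets H' 3" by (auto simp: nsets_def card_eq_0_iff intro: card_ge_0_finite)
  then obtain i j k where "i \<in> H'" "j \<in> H'" "k \<in> H'" "i < j" "j < k"
    unfolding ordered_nsets_3_eq by auto
  then show ?thesis using that H' by blast
qed

text \<open>
  Colour a pair \<open>i < j\<close> by whether the minimum of \<open>w i\<close> and \<open>w j\<close> is in \<open>U\<close> and by the set of
  coordinates in which \<open>w\<close> does not decrease from \<open>i\<close> to \<open>j\<close>.  On a homogeneous set of size at least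
  \<open>p\<close> all minima are in \<open>U\<close>, and every coordinate is monotone.  Hence for three indices
  \<open>i < j < k\<close> of such a set \<open>w j\<close> is, in each coordinate, at least \<open>w i\<close> or at least \<open>w k\<close>.
\<close>
lemma middle_above_meet:
  fixes p :: nat
  shows "\<exists>r::nat. \<forall>(U :: ('k::finite \<Rightarrow> real) set) w.
     (\<forall>H\<subseteq>{..<r}. card H = p \<longrightarrow> (\<exists>i\<in>H. \<exists>j\<in>H. i \<noteq> j \<and> inf (w i) (w j) \<in> U)) \<longrightarrow>
     (\<exists>i<r. \<exists>j<r. \<exists>k<r. k \<noteq> i \<and> k \<noteq> j \<and> inf (w i) (w j) \<in> U \<and> inf (w i) (w j) \<le> w k)"
proof -
  obtain r where r: "\<And>g :: nat \<Rightarrow> nat \<Rightarrow> bool \<times> 'k set. \<exists>c. \<exists>H\<subseteq>{..<r}. card H = max p 3 \<and>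
           (\<forall>i\<in>H. \<forall>j\<in>H. i < j \<longrightarrow> g i j = c)"
    using ramsey_pairs_coloured[where 'c = "bool \<times> 'k set"] by metis
  have mid: "\<exists>i<r. \<exists>j<r. \<exists>k<r. k \<noteq> i \<and> k \<noteq> j \<and> inf (w i) (w j) \<in> U \<and> inf (w i) (w j) \<le> w k"
    if dep: "\<forall>H\<subseteq>{..<r}. card H = p \<longrightarrow> (\<exists>i\<in>H. \<exists>j\<in>H. i \<noteq> j \<and> inf (w i) (w j) \<in> U)"
    for U :: "('k \<Rightarrow> real) set" and w
  proof -
    obtain b K H where H: "H \<subseteq> {..<r}" "card H = max p 3"
      and col: "\<And>i j. i \<in> H \<Longrightarrow> j \<in> H \<Longrightarrow> i < j \<Longrightarrow>
        (inf (w i) (w j) \<in> U) = b \<and> {x. w i x \<le> w j x} = K"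
      using r[of "\<lambda>i j. (inf (w i) (w j) \<in> U, {x. w i x \<le> w j x})"] by auto
    obtain H' where H': "H' \<subseteq> H" "card H' = p"
      using H(2) obtain_subset_with_card_n[of p H] by auto
    then obtain i j where ij: "i \<in> H" "j \<in> H" "i \<noteq> j" "inf (w i) (w j) \<in> U"
      using dep[rule_format, of H'] H by blast
    then have b using col[of i j] col[of j i] by (metis inf_commute linorder_neqE_nat)
    obtain i j k where ijk: "i \<in> H" "j \<in> H" "k \<in> H" "i < j" "j < k"
      using obtain_three_increasing[of H] H(2) by auto
    have "inf (w i) (w k) \<le> w j"
    proof (rule le_funI)
      fix x
      show "inf (w i) (w k) x \<le> w j x"
        \<comment> \<open>The coordinates in \<open>K\<close> increase along \<open>H\<close>, the others decrease.\<close>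
      proof (cases "x \<in> K")
        case True
        then show ?thesis using col[of i j] ijk by (auto simp: le_infI1)
      next
        case False
        then have "\<not> w j x \<le> w k x" using col[of j k] ijk by blast
        then show ?thesis by (auto simp: le_infI2)
      qed
    qed
    moreover have "inf (w i) (w k) \<in> U" using col[of i k] ijk \<open>b\<close> by auto
    ultimately show ?thesis
      using ijk H(1) by (intro exI[of _ i] exI[of _ k] exI[of _ j] conjI) auto
  qed
  show ?thesis by (rule exI[of _ r], intro allI impI, rule mid)
qed

section \<open>Random samples\<close>

text \<open>
  A uniformly random function hits the bad set at \<open>k\<close> with probability at most \<open>b / card X\<close>:
  the values at all other indices determine that set, and the value at \<open>k\<close> is independent of them.
\<close>
lemma card_functions_with_bad_value:
  fixes X :: "'x set" and I :: "'i set" and bad :: "'x \<Rightarrow> 'x \<Rightarrow> 'x set" and b :: nat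
  assumes "finite X" "finite I" "i \<in> I" "j \<in> I" "k \<in> I" "k \<noteq> i" "k \<noteq> j"
    and bad: "\<And>x y. x \<in> X \<Longrightarrow> y \<in> X \<Longrightarrow> card (bad x y \<inter> X) \<le> b"
  shows "card {f \<in> I \<rightarrow>\<^sub>E X. f k \<in> bad (f i) (f j)} \<le> card X ^ (card I - 1) * b"
proof -
  let ?J = "I - {k}"
  let ?B = "{f \<in> I \<rightarrow>\<^sub>E X. f k \<in> bad (f i) (f j)}"
  let ?S = "SIGMA g : ?J \<rightarrow>\<^sub>E X. bad (g i) (g j) \<inter> X"
  let ?h = "\<lambda>f. (restrict f ?J, f k)"
  have fin: "finite (?J \<rightarrow>\<^sub>E X)" using assms by (simp add: finite_PiE)
  have "inj_on ?h ?B"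
  proof (rule inj_onI)
    fix f g assume fg: "f \<in> ?B" "g \<in> ?B" "?h f = ?h g"
    show "f = g"
    proof
      fix x
      consider "x = k" | "x \<in> ?J" | "x \<notin> I" by blast
      then show "f x = g x"
      proof cases
        case 2
        then show ?thesis using fg(3) by (metis (no_types, lifting) Pair_inject restrict_apply')
      qed (use fg in \<open>auto simp: PiE_def extensional_def\<close>)
    qed
  qed
  moreover have "?h ` ?B \<subseteq> ?S" using assms(3-7) by (auto simp: PiE_iff extensional_def split: if_splits)
  moreover have "finite ?S" using fin assms(1) by (intro finite_SigmaI) auto
  ultimately have "card ?B \<le> card ?S" by (metis (lifting) card_inj_on_le)
  also have "\<dots> = (\<Sum>g\<in>?J \<rightarrow>\<^sub>E X. card (bad (g i) (g j) \<inter> X))"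
    using fin assms(1) by (intro card_SigmaI) auto
  also have "\<dots> \<le> (\<Sum>g\<in>?J \<rightarrow>\<^sub>E X. b)"
    using assms(3-7) by (intro sum_mono bad) auto
  also have "\<dots> = card X ^ (card I - 1) * b"
    using assms(2,5) by (simp add: card_funcsetE)
  finally show ?thesis .
qed

text \<open>
  The probabilistic method with a union bound over at most \<open>r\<close> cubed triples of indices, each of
  which is bad with probability at most \<open>1 / M\<close>.
\<close>
lemma sample_avoiding_sparse_triples:
  fixes X :: "'x set" and bad :: "'x \<Rightarrow> 'x \<Rightarrow> 'x set" and r M :: nat
  assumes X: "finite X" "X \<noteq> {}" and M: "r ^ 3 < M"
    and bad: "\<And>x y. x \<in> X \<Longrightarrow> y \<in> X \<Longrightarrow> M * card (bad x y \<inter> X) \<le> card X"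
  obtains f where "\<And>i. i < r \<Longrightarrow> f i \<in> X"
    and "\<And>i j k. i < r \<Longrightarrow> j < r \<Longrightarrow> k < r \<Longrightarrow> k \<noteq> i \<Longrightarrow> k \<noteq> j \<Longrightarrow> f k \<notin> bad (f i) (f j)"
proof -
  define B where "B = (\<lambda>(i, j, k). {f \<in> {..<r} \<rightarrow>\<^sub>E X. f k \<in> bad (f i) (f j)})"
  define T where "T = {(i, j, k) \<in> {..<r} \<times> {..<r} \<times> {..<r}. k \<noteq> i \<and> k \<noteq> j}"
  have T_sub: "T \<subseteq> {..<r} \<times> {..<r} \<times> {..<r}" by (auto simp: T_def)
  have finT: "finite T" using T_sub by (rule finite_subset) auto
  have cardT: "card T \<le> r ^ 3"
    using card_mono[OF _ T_sub] by (simp add: card_cartesian_product power3_eq_cube)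
  have cardB: "M * card (B t) \<le> card X ^ r" if "t \<in> T" for t
  proof -
    obtain i j k where t: "t = (i, j, k)" by (cases t)
    have ijk: "i < r" "j < r" "k < r" "k \<noteq> i" "k \<noteq> j" using that by (auto simp: T_def t)
    have "card (bad x y \<inter> X) \<le> card X div M" if "x \<in> X" "y \<in> X" for x y
      using bad[OF that] M by (simp add: less_eq_div_iff_mult_less_eq mult.commute)
    then have "card (B t) \<le> card X ^ (r - 1) * (card X div M)"
      using card_functions_with_bad_value[OF X(1), of "{..<r}" i j k bad "card X div M"] ijk
      by (simp add: B_def t)
    then have "M * card (B t) \<le> card X ^ (r - 1) * (M * (card X div M))"
      by (metis mult.left_commute mult_le_mono2)
    also have "\<dots> \<le> card X ^ (r - 1) * card X" by simp
    also have "\<dots> = card X ^ r" using ijk(1) by (metis gr_implies_not0 power_eq_if mult.commute)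
    finally show ?thesis .
  qed
  have "M * card (\<Union>t\<in>T. B t) \<le> M * (\<Sum>t\<in>T. card (B t))"
    using finT by (intro mult_le_mono2 card_UN_le)
  also have "\<dots> \<le> (\<Sum>t\<in>T. card X ^ r)"
    unfolding sum_distrib_left by (intro sum_mono cardB)
  also have "\<dots> \<le> r ^ 3 * card X ^ r" using cardT by simp
  also have "\<dots> < M * card X ^ r" using M X by (simp add: card_gt_0_iff)
  finally have "card (\<Union>t\<in>T. B t) < card ({..<r} \<rightarrow>\<^sub>E X)" by (simp add: card_funcsetE)
  moreover have "(\<Union>t\<in>T. B t) \<subseteq> {..<r} \<rightarrow>\<^sub>E X" by (auto simp: B_def)
  ultimately have "\<not> ({..<r} \<rightarrow>\<^sub>E X) \<subseteq> (\<Union>t\<in>T. B t)"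
    by (metis less_irrefl subset_antisym)
  then obtain f where f: "f \<in> {..<r} \<rightarrow>\<^sub>E X" "f \<notin> (\<Union>t\<in>T. B t)"
    by (meson subsetI)
  show ?thesis
  proof (rule that)
    show "f i \<in> X" if "i < r" for i using f(1) that by auto
    show "f k \<notin> bad (f i) (f j)" if "i < r" "j < r" "k < r" "k \<noteq> i" "k \<noteq> j" for i j k
    proof -
      have "(i, j, k) \<in> T" using that by (simp add: T_def)
      then have "f \<notin> B (i, j, k)" using f(2) by blast
      then show ?thesis using f(1) by (simp add: B_def)
    qed
  qed
qed

section \<open>Points of the up-set below much of the weight\<close>

definition meets_among :: "nat \<Rightarrow> ('k \<Rightarrow> real) set \<Rightarrow> ('k \<Rightarrow> real) set \<Rightarrow> bool" where
  "meets_among p W U \<longleftrightarrow> (\<forall>G\<subseteq>W. card G = p \<longrightarrow> (\<exists>x\<in>G. \<exists>y\<in>G. x \<noteq> y \<and> inf x y \<in> U))"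

text \<open>
  If no point of \<open>U\<close> is heavy, then for given \<open>x\<close> and \<open>y\<close> whose minimum is in \<open>U\<close>, few members of
  a sample are expected above that minimum, and a sample without any such triple exists.  The sample
  inherits the condition on \<open>p\<close> members even if points are repeated, because a point of \<open>W\<close> is its own
  minimum with itself and belongs to \<open>U\<close>.  This contradicts \<open>middle_above_meet\<close>.
\<close>
lemma heavy_point:
  fixes p :: nat
  shows "\<exists>M::nat. 0 < M \<and> (\<forall>(U :: ('k::finite \<Rightarrow> real) set) W (\<omega> :: _ \<Rightarrow> nat).
     finite W \<longrightarrow> W \<subseteq> U \<longrightarrow> meets_among p W U \<longrightarrow> sum \<omega> W \<noteq> 0 \<longrightarrow>
     (\<exists>u\<in>U. sum \<omega> W \<le> M * (\<Sum>w | w \<in> W \<and> u \<le> w. \<omega> w)))"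
proof -
  from middle_above_meet[where 'k = 'k and p = p]
  obtain r :: nat where r: "\<forall>(U :: ('k \<Rightarrow> real) set) w.
     (\<forall>H\<subseteq>{..<r}. card H = p \<longrightarrow> (\<exists>i\<in>H. \<exists>j\<in>H. i \<noteq> j \<and> inf (w i) (w j) \<in> U)) \<longrightarrow>
     (\<exists>i<r. \<exists>j<r. \<exists>k<r. k \<noteq> i \<and> k \<noteq> j \<and> inf (w i) (w j) \<in> U \<and> inf (w i) (w j) \<le> w k)" ..
  define M where "M = Suc (r ^ 3)"
  have "\<exists>u\<in>U. sum \<omega> W \<le> M * (\<Sum>w | w \<in> W \<and> u \<le> w. \<omega> w)"
    if W: "finite W" "W \<subseteq> U" "meets_among p W U" "sum \<omega> W \<noteq> 0"
    for U W :: "('k \<Rightarrow> real) set" and \<omega> :: "_ \<Rightarrow> nat"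
  proof (rule ccontr)
    assume neg: "\<not> ?thesis"
    \<comment> \<open>A uniform choice among \<open>\<omega> w\<close> copies of each \<open>w\<close> realises the weights.\<close>
    define X where "X = (SIGMA w : W. {..<\<omega> w})"
    define bad :: "('k \<Rightarrow> real) \<times> nat \<Rightarrow> ('k \<Rightarrow> real) \<times> nat \<Rightarrow> (('k \<Rightarrow> real) \<times> nat) set"
      where "bad = (\<lambda>x y. {z. inf (fst x) (fst y) \<in> U \<and> inf (fst x) (fst y) \<le> fst z})"
    have cardX: "card X = sum \<omega> W" using W(1) by (simp add: X_def)
    have finX: "finite X" using W(1) by (simp add: X_def)
    have "X \<noteq> {}" using cardX W(4) by auto
    have bad_small: "M * card (bad x y \<inter> X) \<le> card X" for x y
    proof (cases "inf (fst x) (fst y) \<in> U")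
      case True
      let ?u = "inf (fst x) (fst y)"
      have "bad x y \<inter> X = (SIGMA w : {w \<in> W. ?u \<le> w}. {..<\<omega> w})"
        using True by (auto simp: bad_def X_def)
      then have "card (bad x y \<inter> X) = (\<Sum>w | w \<in> W \<and> ?u \<le> w. \<omega> w)"
        using W(1) by simp
      then show ?thesis using neg True cardX by (metis nat_le_linear)
    qed (simp add: bad_def)
    obtain f where f: "\<And>i. i < r \<Longrightarrow> f i \<in> X"
      and avoid: "\<And>i j k. i < r \<Longrightarrow> j < r \<Longrightarrow> k < r \<Longrightarrow> k \<noteq> i \<Longrightarrow> k \<noteq> j \<Longrightarrow> f k \<notin> bad (f i) (f j)"
      using sample_avoiding_sparse_triples[OF finX \<open>X \<noteq> {}\<close>, of r M bad] bad_small
      by (auto simp: M_def)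
    have "\<exists>i\<in>H. \<exists>j\<in>H. i \<noteq> j \<and> inf (fst (f i)) (fst (f j)) \<in> U"
      if H: "H \<subseteq> {..<r}" "card H = p" for H
    proof -
      have inW: "fst (f i) \<in> W" if "i \<in> H" for i using f[of i] that H(1) unfolding X_def by force
      show ?thesis
      proof (cases "inj_on (\<lambda>i. fst (f i)) H")
        case True
        then have "card ((\<lambda>i. fst (f i)) ` H) = p" using H(2) by (simp add: card_image)
        moreover have "(\<lambda>i. fst (f i)) ` H \<subseteq> W" using inW by blast
        ultimately obtain x y where "x \<in> (\<lambda>i. fst (f i)) ` H" "y \<in> (\<lambda>i. fst (f i)) ` H"
          "x \<noteq> y" "inf x y \<in> U"
          using W(3)[unfolded meets_among_def, rule_format, of "(\<lambda>i. fst (f i)) ` H"] by blast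
        then obtain i j where "i \<in> H" "j \<in> H" "fst (f i) \<noteq> fst (f j)"
          "inf (fst (f i)) (fst (f j)) \<in> U"
          by (elim imageE) simp
        then show ?thesis by (intro bexI[of _ i] bexI[of _ j]) auto
      next
        case False
        then obtain i j where ij: "i \<in> H" "j \<in> H" "i \<noteq> j" "fst (f i) = fst (f j)"
          unfolding inj_on_def by blast
        then have "inf (fst (f i)) (fst (f j)) \<in> U" using inW W(2) by (simp add: subsetD)
        then show ?thesis using ij(1-3) by (intro bexI[of _ i] bexI[of _ j]) auto
      qed
    qed
    then obtain i j k where "i < r" "j < r" "k < r" "k \<noteq> i" "k \<noteq> j"
      "inf (fst (f i)) (fst (f j)) \<in> U" "inf (fst (f i)) (fst (f j)) \<le> fst (f k)"
      using r[rule_format, of "\<lambda>i. fst (f i)" U] by blast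
    then show False using avoid[of i j k] by (simp add: bad_def)
  qed
  moreover have "0 < M" by (simp add: M_def)
  ultimately show ?thesis by (intro exI[of _ M] conjI allI impI)
qed

section \<open>Multiplicative weights\<close>

text \<open>
  Extend the list one point at a time, always by a point that is heavy for the weights
  \<open>(1/2) ^ h w\<close>, where \<open>h w\<close> is the number of points of the list that are related to \<open>w\<close> so far.
  Each step multiplies the total weight by at most \<open>1 - 1 / (2 * M)\<close>, so it decays
  exponentially with the length of the list; as it bounds every single \<open>(1/2) ^ h w\<close>, each \<open>h w\<close>
  grows linearly, up to a loss of \<open>ln (card W)\<close> that a long list makes negligible.
\<close>
lemma uniform_list_of_heavy_points:
  fixes R :: "'u \<Rightarrow> 'w \<Rightarrow> bool" and M :: nat
  assumes W: "finite W" "W \<noteq> {}" and M: "0 < M"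
    and heavy: "\<And>\<omega> :: 'w \<Rightarrow> nat. sum \<omega> W \<noteq> 0 \<Longrightarrow> \<exists>u\<in>U. sum \<omega> W \<le> M * (\<Sum>w | w \<in> W \<and> R u w. \<omega> w)"
  obtains us where "us \<noteq> []" "set us \<subseteq> U"
    "\<And>w. w \<in> W \<Longrightarrow> length us \<le> 4 * M * length (filter (\<lambda>u. R u w) us)"
proof -
  define h where "h = (\<lambda>us w. length (filter (\<lambda>u. R u w) us))"
  define \<Phi> where "\<Phi> = (\<lambda>us. \<Sum>w\<in>W. (1/2 :: real) ^ h us w)"
  have h_le: "h us w \<le> length us" for us w by (simp add: h_def)
  have step: "\<exists>u\<in>U. \<Phi> (u # us) \<le> (1 - 1 / (2 * M)) * \<Phi> us" for us
  proof -
    \<comment> \<open>The current weights, scaled by a power of two to become natural numbers.\<close>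
    define \<omega> :: "'w \<Rightarrow> nat" where "\<omega> = (\<lambda>w. 2 ^ (length us - h us w))"
    have \<omega>: "real (\<omega> w) = 2 ^ length us * (1/2) ^ h us w" for w
    proof -
      have "(2 :: real) ^ length us = 2 ^ (length us - h us w) * 2 ^ h us w"
        using h_le[of us w] by (simp flip: power_add)
      then show ?thesis by (simp add: \<omega>_def power_divide)
    qed
    have "sum \<omega> W \<noteq> 0" using W by (auto simp: \<omega>_def)
    then obtain u where u: "u \<in> U" "sum \<omega> W \<le> M * (\<Sum>w | w \<in> W \<and> R u w. \<omega> w)"
      using heavy by blast
    have "real (sum \<omega> W) \<le> real (M * (\<Sum>w | w \<in> W \<and> R u w. \<omega> w))"
      using u(2) by (simp only: of_nat_le_iff)
    then have "2 ^ length us * \<Phi> us \<le> 2 ^ length us * (M * (\<Sum>w | w \<in> W \<and> R u w. (1/2) ^ h us w))"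
      by (simp add: \<omega> \<Phi>_def mult.left_commute flip: sum_distrib_left)
    then have le: "\<Phi> us \<le> M * (\<Sum>w | w \<in> W \<and> R u w. (1/2) ^ h us w)" by simp
    have "\<Phi> (u # us) = (\<Sum>w\<in>W. (1/2) ^ h us w - (if R u w then 1/2 * (1/2) ^ h us w else 0))"
      unfolding \<Phi>_def by (rule sum.cong) (auto simp: h_def)
    also have "\<dots> = \<Phi> us - 1/2 * (\<Sum>w | w \<in> W \<and> R u w. (1/2) ^ h us w)"
      unfolding sum_subtractf \<Phi>_def sum_distrib_left
      using W by (simp add: sum.inter_filter if_distrib cong: if_cong)
    also have "\<dots> \<le> (1 - 1 / (2 * M)) * \<Phi> us"
      using le M by (simp add: field_simps)
    finally show ?thesis using u(1) by blast
  qed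
  have run: "\<exists>us. set us \<subseteq> U \<and> length us = n \<and> \<Phi> us \<le> card W * (1 - 1 / (2 * M)) ^ n" for n
  proof (induction n)
    case 0
    then show ?case by (auto simp: \<Phi>_def h_def)
  next
    case (Suc n)
    then obtain us where us: "set us \<subseteq> U" "length us = n" "\<Phi> us \<le> card W * (1 - 1 / (2 * M)) ^ n"
      by blast
    obtain u where u: "u \<in> U" "\<Phi> (u # us) \<le> (1 - 1 / (2 * M)) * \<Phi> us"
      using step by blast
    have "(1 - 1 / (2 * M)) * \<Phi> us \<le> (1 - 1 / (2 * M)) * (card W * (1 - 1 / (2 * M)) ^ n)"
      using M us(3) by (intro mult_left_mono) (auto simp: field_simps)
    then show ?case using u us by (intro exI[of _ "u # us"]) (auto simp: mult.left_commute)
  qed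
  define n where "n = Suc (nat \<lceil>4 * M * ln (card W)\<rceil>)"
  have n: "4 * M * ln (card W) \<le> n" unfolding n_def by linarith
  obtain us where us: "set us \<subseteq> U" "length us = n" "\<Phi> us \<le> card W * (1 - 1 / (2 * M)) ^ n"
    using run by blast
  have "n \<le> 4 * M * h us w" if "w \<in> W" for w
  proof -
    \<comment> \<open>Comparing \<open>1/2\<close> with \<open>exp (-1)\<close> lets all estimates be made with \<open>exp\<close>.\<close>
    have "exp (- real (h us w)) = exp (-1) ^ h us w" by (simp flip: exp_of_nat_mult)
    also have "\<dots> \<le> (1/2) ^ h us w"
      using exp_ge_add_one_self[of 1] by (intro power_mono) (auto simp: exp_minus field_simps)
    also have "\<dots> \<le> \<Phi> us"
      unfolding \<Phi>_def using W that by (intro member_le_sum) auto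
    also have "\<dots> \<le> card W * (1 - 1 / (2 * M)) ^ n" by (rule us)
    also have "\<dots> \<le> card W * exp (- 1 / (2 * M)) ^ n"
      using exp_ge_add_one_self[of "- 1 / (2 * M)"] M
      by (intro mult_left_mono power_mono) (auto simp: field_simps)
    also have "\<dots> = exp (ln (card W) - n / (2 * M))"
      using W by (simp add: exp_diff exp_minus field_simps card_gt_0_iff flip: exp_of_nat_mult)
    finally have "n / (2 * M) \<le> h us w + ln (card W)" by simp
    then have "2 * n \<le> 4 * M * h us w + 4 * M * ln (card W)"
      using M by (simp add: field_simps)
    then have "real n \<le> real (4 * M * h us w)" using n by simp
    then show ?thesis by (simp only: of_nat_le_iff)
  qed
  moreover have "us \<noteq> []" using us(2) by (auto simp: n_def)
  ultimately show ?thesis using us(1,2) that[of us] by (simp add: h_def)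
qed

section \<open>Quantile grids\<close>

text \<open>
  The thresholds are the least values of \<open>a\<close> below or at which at least a fraction \<open>j / D\<close> of the
  indices lies, for \<open>j = 0, ..., D\<close>.  They may coincide if values of \<open>a\<close> are repeated; what counts is that
  rounding down to a threshold skips less than a fraction \<open>1 / D\<close> of the indices.
\<close>
lemma quantiles:
  fixes a :: "'i \<Rightarrow> real" and D :: nat
  assumes "finite I"
  obtains T where "finite T" "card T \<le> D + 1"
    "\<And>y i. i \<in> I \<Longrightarrow> a i \<le> y \<Longrightarrow> \<exists>t\<in>T. t \<le> y \<and> D * card {i\<in>I. t < a i \<and> a i \<le> y} < card I"
proof -
  define F where "F = (\<lambda>y. card {i\<in>I. a i \<le> y})"
  define \<tau> where "\<tau> = (\<lambda>j. Min {y \<in> a ` I. j * card I \<le> D * F y})"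
  have "\<exists>t\<in>\<tau> ` {..D}. t \<le> y \<and> D * card {i\<in>I. t < a i \<and> a i \<le> y} < card I"
    if "i \<in> I" "a i \<le> y" for y i
  proof -
    define y' where "y' = Max {z \<in> a ` I. z \<le> y}"
    have fin: "finite {z \<in> a ` I. z \<le> y}" "{z \<in> a ` I. z \<le> y} \<noteq> {}" using assms that by auto
    have y': "y' \<in> a ` I" "y' \<le> y" using Max_in[OF fin] by (auto simp: y'_def)
    have F_y': "F y = F y'"
    proof -
      have "a k \<le> y'" if "k \<in> I" "a k \<le> y" for k
        using that fin(1) by (auto simp: y'_def)
      then show ?thesis using y'(2) unfolding F_def by (intro arg_cong[of _ _ card]) force
    qed
    have pos: "card I > 0" using that(1) assms by (auto simp: card_gt_0_iff)
    define j where "j = D * F y div card I"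
    have "F y \<le> card I" unfolding F_def using assms by (intro card_mono) auto
    then have "D * F y \<le> D * card I" by simp
    then have jD: "j \<le> D" unfolding j_def using pos by (metis div_le_mono div_mult_self_is_m)
    have j_le: "j * card I \<le> D * F y" by (simp add: j_def)
    have fin': "finite {y \<in> a ` I. j * card I \<le> D * F y}" using assms by simp
    have in': "y' \<in> {y \<in> a ` I. j * card I \<le> D * F y}" using y' j_le F_y' by simp
    have "\<tau> j \<le> y'" unfolding \<tau>_def using fin' in' by (rule Min_le)
    then have le: "\<tau> j \<le> y" using y' by simp
    have \<tau>: "j * card I \<le> D * F (\<tau> j)"
      using Min_in[OF fin'] in' unfolding \<tau>_def by blast
    have "{i\<in>I. \<tau> j < a i \<and> a i \<le> y} = {i\<in>I. a i \<le> y} - {i\<in>I. a i \<le> \<tau> j}"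
      by auto
    moreover have "{i\<in>I. a i \<le> \<tau> j} \<subseteq> {i\<in>I. a i \<le> y}" using le by auto
    ultimately have "card {i\<in>I. \<tau> j < a i \<and> a i \<le> y} = F y - F (\<tau> j)"
      using assms by (simp add: F_def card_Diff_subset)
    moreover have "D * F y < j * card I + card I"
      using pos mod_less_divisor[of "card I" "D * F y"] div_mult_mod_eq[of "D * F y" "card I"]
      unfolding j_def by linarith
    ultimately have "D * card {i\<in>I. \<tau> j < a i \<and> a i \<le> y} < card I"
      using \<tau> pos by (simp add: diff_mult_distrib2)
    then show ?thesis using le jD by blast
  qed
  moreover have "card (\<tau> ` {..D}) \<le> D + 1" using card_image_le[of "{..D}" \<tau>] by simp
  ultimately show ?thesis using that[of "\<tau> ` {..D}"] by blast
qed

text \<open>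
  Take quantiles with \<open>D = L * CARD('k)\<close> in each coordinate.  Rounding \<open>w\<close> down to the grid loses in
  each coordinate less than a fraction \<open>1 / D\<close> of the list, hence in total less than the fraction
  \<open>1 / L\<close> that was below \<open>w\<close>.  Some member of the list remains below the rounded point, which
  therefore lies in the up-set \<open>U\<close>.
\<close>
lemma grid_net:
  fixes U :: "('k::finite \<Rightarrow> real) set" and L :: nat
  assumes up: "\<And>u v. u \<in> U \<Longrightarrow> u \<le> v \<Longrightarrow> v \<in> U"
    and us: "us \<noteq> []" "set us \<subseteq> U"
    and dense: "\<And>w. w \<in> W \<Longrightarrow> length us \<le> L * length (filter (\<lambda>u. u \<le> w) us)"
  obtains S where "S \<subseteq> U" "finite S" "card S \<le> (L * CARD('k) + 1) ^ CARD('k)"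
    "\<And>w. w \<in> W \<Longrightarrow> \<exists>s\<in>S. s \<le> w"
proof -
  define I where "I = {..<length us}"
  define m where "m = CARD('k)"
  define D where "D = L * m"
  have I: "finite I" "card I = length us" by (auto simp: I_def)
  have m: "m > 0" by (simp add: m_def)
  have "\<forall>k. \<exists>T. finite T \<and> card T \<le> D + 1 \<and> (\<forall>y. \<forall>i\<in>I. (us ! i) k \<le> y \<longrightarrow>
      (\<exists>t\<in>T. t \<le> y \<and> D * card {i\<in>I. t < (us ! i) k \<and> (us ! i) k \<le> y} < card I))"
    (is "\<forall>k. \<exists>T. ?grid k T")
  proof
    show "\<exists>T. ?grid k T" for k
      by (rule quantiles[OF I(1), of D "\<lambda>i. (us ! i) k"]) blast
  qed
  from choice[OF this] obtain T where grid: "\<forall>k. ?grid k (T k)" ..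
  then have T: "\<And>k. finite (T k)" "\<And>k. card (T k) \<le> D + 1" by blast+
  define S where "S = U \<inter> Pi UNIV T"
  have fin: "finite (PiE UNIV T)" using T(1) by (intro finite_PiE) auto
  have "card (PiE UNIV T) \<le> (D + 1) ^ m"
    using T(2) prod_mono[of "UNIV :: 'k set" "\<lambda>k. card (T k)" "\<lambda>_. D + 1"]
    by (simp add: card_PiE m_def)
  then have cardS: "finite S" "card S \<le> (D + 1) ^ m"
    using fin card_mono[OF fin, of S] finite_subset[OF _ fin, of S]
    by (auto simp: S_def PiE_UNIV_domain)
  have "\<exists>s\<in>S. s \<le> w" if w: "w \<in> W" for w
  proof -
    define A where "A = {i\<in>I. us ! i \<le> w}"
    have A: "length us \<le> L * card A"
      using dense[OF w] by (simp add: A_def I_def length_filter_conv_card conj_commute)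
    then have "A \<noteq> {}" using us(1) by auto
    then obtain i0 where i0: "i0 \<in> I" "\<And>k. (us ! i0) k \<le> w k"
      by (auto simp: A_def le_fun_def)
    have "\<forall>k. \<exists>t. t \<in> T k \<and> t \<le> w k \<and>
        D * card {i\<in>I. t < (us ! i) k \<and> (us ! i) k \<le> w k} < card I"
      using grid i0 by blast
    from choice[OF this] obtain v where v: "\<And>k. v k \<in> T k" "\<And>k. v k \<le> w k"
      and few: "\<And>k. D * card {i\<in>I. v k < (us ! i) k \<and> (us ! i) k \<le> w k} < card I"
      by blast
    \<comment> \<open>\<open>C k\<close> collects the members of the list that are lost by rounding coordinate \<open>k\<close>.\<close>
    define C where "C = (\<lambda>k. {i\<in>I. v k < (us ! i) k \<and> (us ! i) k \<le> w k})"
    have "\<not> A \<subseteq> (\<Union>k. C k)"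
    proof
      assume "A \<subseteq> (\<Union>k. C k)"
      then have "card A \<le> card (\<Union>k. C k)" using I by (intro card_mono) (auto simp: C_def)
      also have "\<dots> \<le> (\<Sum>k\<in>UNIV. card (C k))" by (intro card_UN_le) simp
      finally have "D * card A \<le> (\<Sum>k\<in>UNIV. D * card (C k))"
        by (metis mult_le_mono2 sum_distrib_left)
      also have "\<dots> < (\<Sum>k\<in>(UNIV::'k set). card I)"
        using few by (intro sum_strict_mono) (auto simp: C_def)
      also have "\<dots> = m * length us" using I by (simp add: m_def)
      also have "\<dots> \<le> m * (L * card A)" using A by simp
      finally show False by (simp add: D_def mult.assoc mult.left_commute)
    qed
    then obtain i where i: "i \<in> A" "\<And>k. i \<notin> C k" by blast
    have "us ! i \<le> v"
      using i by (auto simp: A_def C_def le_fun_def not_less)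
    moreover have "us ! i \<in> U" using i(1) us(2) by (auto simp: A_def I_def)
    ultimately have "v \<in> U" using up by blast
    then have "v \<in> S" using v by (simp add: S_def)
    then show ?thesis using v(2) by (auto simp: le_fun_def)
  qed
  then show ?thesis using that[of S] cardS by (auto simp: S_def D_def m_def)
qed

lemma up_set_pq:
  fixes p :: nat
  shows "\<exists>c::nat. \<forall>(U :: ('k::finite \<Rightarrow> real) set) W.
     (\<forall>u\<in>U. \<forall>v. u \<le> v \<longrightarrow> v \<in> U) \<longrightarrow> finite W \<longrightarrow> W \<subseteq> U \<longrightarrow> meets_among p W U \<longrightarrow>
     (\<exists>S\<subseteq>U. finite S \<and> card S \<le> c \<and> (\<forall>w\<in>W. \<exists>s\<in>S. s \<le> w))"
proof -
  from heavy_point[where 'k = 'k and p = p]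
  obtain M where M: "0 < M \<and> (\<forall>(U :: ('k \<Rightarrow> real) set) W (\<omega> :: _ \<Rightarrow> nat).
     finite W \<longrightarrow> W \<subseteq> U \<longrightarrow> meets_among p W U \<longrightarrow> sum \<omega> W \<noteq> 0 \<longrightarrow>
     (\<exists>u\<in>U. sum \<omega> W \<le> M * (\<Sum>w | w \<in> W \<and> u \<le> w. \<omega> w)))" ..
  have "\<exists>S\<subseteq>U. finite S \<and> card S \<le> (4 * M * CARD('k) + 1) ^ CARD('k) \<and> (\<forall>w\<in>W. \<exists>s\<in>S. s \<le> w)"
    if up: "\<forall>u\<in>U. \<forall>v. u \<le> v \<longrightarrow> v \<in> U" and W: "finite W" "W \<subseteq> U" "meets_among p W U"
    for U W :: "('k \<Rightarrow> real) set"
  proof (cases "W = {}")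
    case True
    then show ?thesis by (intro exI[of _ "{}"]) auto
  next
    case False
    have hv: "\<exists>u\<in>U. sum \<omega> W \<le> M * (\<Sum>w | w \<in> W \<and> u \<le> w. \<omega> w)" if "sum \<omega> W \<noteq> 0" for \<omega> :: "_ \<Rightarrow> nat"
      by (rule M[THEN conjunct2, rule_format, OF W that])
    obtain us where us: "us \<noteq> []" "set us \<subseteq> U"
      "\<And>w. w \<in> W \<Longrightarrow> length us \<le> 4 * M * length (filter (\<lambda>u. u \<le> w) us)"
      by (rule uniform_list_of_heavy_points[OF W(1) False M[THEN conjunct1], of U "(\<le>)"])
        (erule hv, rule that)
    obtain S where "S \<subseteq> U" "finite S" "card S \<le> (4 * M * CARD('k) + 1) ^ CARD('k)"
      "\<And>w. w \<in> W \<Longrightarrow> \<exists>s\<in>S. s \<le> w"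
      using grid_net[of U us W "4 * M"] up us by blast
    then show ?thesis by blast
  qed
  then show ?thesis by blast
qed

section \<open>Boxes as vectors\<close>

text \<open>
  The lower bounds are negated so that a box grows with every coordinate of its code.
\<close>
definition box_of :: "('n + 'n \<Rightarrow> real) \<Rightarrow> (real ^ 'n) set" where
  "box_of u = cbox (\<chi> i. - u (Inl i)) (\<chi> i. u (Inr i))"

lemma mem_box_of: "x \<in> box_of u \<longleftrightarrow> (\<forall>i. - u (Inl i) \<le> x $ i \<and> x $ i \<le> u (Inr i))"
  by (simp add: box_of_def mem_box_cart)

lemma box_of_mono: "u \<le> v \<Longrightarrow> box_of u \<subseteq> box_of v"
  by (auto simp: mem_box_of le_fun_def) (meson neg_le_iff_le order_trans)+

lemma box_of_inf: "box_of (inf u v) = box_of u \<inter> box_of v"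
proof -
  have "- inf a b \<le> t \<longleftrightarrow> - a \<le> t \<and> - b \<le> t" for a b t :: real
    by (auto simp: inf_real_def min_def)
  then show ?thesis by (auto simp: mem_box_of)
qed

lemma boxes_eq_range_box_of: "boxes = range box_of"
proof -
  have "cbox a b = box_of (case_sum (\<lambda>i. - a $ i) (\<lambda>i. b $ i))" for a b :: "real ^ 'n"
    by (simp add: box_of_def)
  then show ?thesis unfolding boxes_def box_of_def by blast
qed

theorem theorem1p8:
  fixes p q :: nat
  assumes "p \<ge> q" and "q \<ge> CARD('n::finite) + 1"
  shows "\<exists>c::nat. \<forall>(P :: (real ^ 'n) set set) (\<B> :: (real ^ 'n) set set).
           monotone_box_property P \<longrightarrow> finite \<B> \<longrightarrow> \<B> \<subseteq> boxes \<longrightarrow>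
           (\<forall>B\<in>\<B>. B \<in> P) \<longrightarrow> pq_condition P p q \<B> \<longrightarrow>
           (\<exists>\<S>. \<S> \<subseteq> boxes \<and> (\<forall>D\<in>\<S>. D \<in> P) \<and> finite \<S> \<and> card \<S> \<le> c \<and>
                 (\<forall>B\<in>\<B>. \<exists>D\<in>\<S>. D \<subseteq> B))"
proof -
  from up_set_pq[where 'k = "'n + 'n" and p = p]
  obtain c where c: "\<forall>(U :: ('n + 'n \<Rightarrow> real) set) W.
     (\<forall>u\<in>U. \<forall>v. u \<le> v \<longrightarrow> v \<in> U) \<longrightarrow> finite W \<longrightarrow> W \<subseteq> U \<longrightarrow> meets_among p W U \<longrightarrow>
     (\<exists>S\<subseteq>U. finite S \<and> card S \<le> c \<and> (\<forall>w\<in>W. \<exists>s\<in>S. s \<le> w))" ..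
  have "\<exists>\<S>. \<S> \<subseteq> boxes \<and> (\<forall>D\<in>\<S>. D \<in> P) \<and> finite \<S> \<and> card \<S> \<le> c \<and>
             (\<forall>B\<in>\<B>. \<exists>D\<in>\<S>. D \<subseteq> B)"
    if P: "monotone_box_property P" and \<B>: "finite \<B>" "\<B> \<subseteq> boxes" "\<forall>B\<in>\<B>. B \<in> P"
      and pq: "pq_condition P p q \<B>" for P \<B> :: "(real ^ 'n) set set"
  proof -
    define U where "U = {u. box_of u \<in> P}"
    have P_up: "box_of v \<in> P" if "box_of u \<in> P" "box_of u \<subseteq> box_of v" for u v
      using P that unfolding monotone_box_property_def boxes_eq_range_box_of by blast
    \<comment> \<open>The empty box has many codes, so one code is chosen for each member of \<open>\<B>\<close>.\<close>
    obtain W where W: "finite W" "inj_on box_of W" "\<B> = box_of ` W"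
      using \<B>(1,2) unfolding boxes_eq_range_box_of
      by (metis finite_imageD subset_image_inj)
    have "meets_among p W U"
      unfolding meets_among_def
    proof (intro allI impI)
      fix G assume G: "G \<subseteq> W" "card G = p"
      then have inj: "inj_on box_of G" using W(2) inj_on_subset by blast
      then have "card (box_of ` G) = p" using G by (simp add: card_image)
      then obtain F where F: "F \<subseteq> box_of ` G" "card F = q" "\<Inter>F \<in> P"
        using pq G(1) \<open>card (box_of ` G) = p\<close>
        unfolding W(3) pq_condition_def intersecting_def by (metis image_mono)
      have "2 \<le> card F" using F(2) assms(2) zero_less_card_finite[where 'a = 'n] by linarith
      then obtain F' where "F' \<subseteq> F" "card F' = 2"
        using obtain_subset_with_card_n by metis
      then obtain A B where AB: "A \<in> F" "B \<in> F" "A \<noteq> B" by (auto simp: card_2_iff)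
      then obtain x y where xy: "x \<in> G" "y \<in> G" "A = box_of x" "B = box_of y" using F(1) by blast
      obtain z where "\<Inter>F = box_of z"
        using F(3) P unfolding monotone_box_property_def boxes_eq_range_box_of by blast
      moreover have "\<Inter>F \<subseteq> box_of (inf x y)" using AB xy by (auto simp: box_of_inf)
      ultimately have "box_of (inf x y) \<in> P" using P_up F(3) by metis
      then show "\<exists>x\<in>G. \<exists>y\<in>G. x \<noteq> y \<and> inf x y \<in> U" using xy AB(3)
        by (intro bexI[of _ x] bexI[of _ y]) (auto simp: U_def)
    qed
    moreover have "W \<subseteq> U" using \<B>(3) W(3) by (auto simp: U_def)
    moreover have "v \<in> U" if "u \<in> U" "u \<le> v" for u v
      using that P_up[of u v] box_of_mono[of u v] by (simp add: U_def)
    ultimately obtain S where S: "S \<subseteq> U" "finite S" "card S \<le> c" "\<forall>w\<in>W. \<exists>s\<in>S. s \<le> w"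
      using c[rule_format, of U W] W(1) by blast
    show ?thesis
    proof (intro exI[of _ "box_of ` S"] conjI)
      show "box_of ` S \<subseteq> boxes" by (auto simp: boxes_eq_range_box_of)
      show "\<forall>D\<in>box_of ` S. D \<in> P" using S(1) by (auto simp: U_def)
      show "finite (box_of ` S)" using S(2) by simp
      show "card (box_of ` S) \<le> c" using S(2,3) card_image_le le_trans by blast
      show "\<forall>B\<in>\<B>. \<exists>D\<in>box_of ` S. D \<subseteq> B"
      proof
        fix B assume "B \<in> \<B>"
        then obtain w where "w \<in> W" "B = box_of w" using W(3) by blast
        then obtain s where "s \<in> S" "s \<le> w" using S(4) by blast
        then show "\<exists>D\<in>box_of ` S. D \<subseteq> B" using \<open>B = box_of w\<close> box_of_mono by blast
      qed
    qed
  qed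
  then show ?thesis by (intro exI[of _ c] allI impI)
qed

end
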